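(* Let $P_r^1,\dots,P_r^L\ge0$ be relay powers with $\sum_{i=1}^LP_r^i\le P_R$. The scalar linear time invariant system $X_{t+1}=\lambda X_t+BU_t+W_t$ can be mean square stabilized using a linear scheme over the Gaussian parallel network if $$\log\left(|\lambda|\right)<\frac14\log\left(1+\sum_{i=1}^{L}\frac{4P_SP_r^i}{2P_SN_d^i+2P_r^iN_r^i+N_d^iN_r^i}\right).$$
   Context: Notation: $\mathbb N=\{0,1,2,\dots\}$, $X_{[0,t]}=(X_0,\dots,X_t)$, $\log$ is base 2, $h(\cdot)$ is differential entropy. Plant (scalar): $X_{t+1}=\lambda X_t+BU_t+W_t$, $t\in\mathbb N$, $X_t,U_t,W_t\in\mathbb R$, $|\lambda|\ge1$, $B\neq0$. $X_0$ is a random variable with $|h(X_0)|<\infty$ and given variance; $\{W_t\}$ is a zero-mean white (i.i.d.) Gaussian sequence of given variance, independent of $X_0$. The system is mean square stabilized if there is a constant $M<\infty$ with $\mathbb E[X_t^2]<M$ for all $t$. Parallel network: a state encoder, $L$ relays $\mathcal R_1,\dots,\mathcal R_L$, and a remote controller that receives the $L$ relay signals over $L$ separate channels. - For $t=1,3,5,\dots$: the encoder sends $S_{e,t}=f_t(X_{[0,t]},U_{[0,t-1]})$ with $\mathbb E[S_{e,t}^2]=2P_S$; relay $i$ receives $Y^i_t=S_{e,t}+Z^i_{r,t}$; and $S^i_{r,t}=R^i_t=0$. - For $t=2,4,6,\dots$: relay $i$ sends $S^i_{r,t}=g^i_t(Y^i_{[0,t-1]})$ with $\mathbb E[(S^i_{r,t})^2]=2P_r^i$;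 the controller receives $R^i_t=S^i_{r,t}+Z^i_{d,t}$, $i=1,\dots,L$; and $S_{e,t}=Y^i_t=0$. The controller applies $U_t=\pi_t(\{R^i_{[0,t]}\}_{i=1}^L)$. The noises $Z^i_{r,t}\sim\mathcal N(0,N_r^i)$ and $Z^i_{d,t}\sim\mathcal N(0,N_d^i)$ are mutually independent, white, and independent of $X_0$ and $\{W_t\}$. A linear scheme is one in which all policies $f_t,g^i_t,\pi_t$ are linear functions of their arguments. *)

theory Defs
  imports "HOL-Probability.Probability"
begin

datatype source = Initial | Process nat | Relay_Noise nat nat | Dest_Noise nat nat

fun source_var ::
  "('w \<Rightarrow> real) \<Rightarrow> (nat \<Rightarrow> 'w \<Rightarrow> real) \<Rightarrow> (nat \<Rightarrow> nat \<Rightarrow> 'w \<Rightarrow> real) \<Rightarrow>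
   (nat \<Rightarrow> nat \<Rightarrow> 'w \<Rightarrow> real) \<Rightarrow> source \<Rightarrow> 'w \<Rightarrow> real"
where
  "source_var X0 W Zr Zd Initial = X0"
| "source_var X0 W Zr Zd (Process t) = W t"
| "source_var X0 W Zr Zd (Relay_Noise i t) = Zr i t"
| "source_var X0 W Zr Zd (Dest_Noise i t) = Zd i t"

text \<open>Relays are numbered \<open>1, \<dots>, L\<close>.\<close>

definition sources :: "nat \<Rightarrow> source set" where
  "sources L = {Initial} \<union> range Process \<union>
     (\<Union>i\<in>{1..L}. range (Relay_Noise i) \<union> range (Dest_Noise i))"

definition gaussian :: "'w measure \<Rightarrow> ('w \<Rightarrow> real) \<Rightarrow> real \<Rightarrow> bool" where
  "gaussian M Z v \<longleftrightarrow> v > 0 \<and> distributed M lborel Z (normal_density 0 (sqrt v))"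

definition linear_encoder ::
  "(nat \<Rightarrow> (nat \<Rightarrow> real) \<Rightarrow> (nat \<Rightarrow> real) \<Rightarrow> real) \<Rightarrow> bool"
where
  "linear_encoder f \<longleftrightarrow>
     (\<forall>t. \<exists>a b. \<forall>x u. f t x u = (\<Sum>k\<le>t. a k * x k) + (\<Sum>k<t. b k * u k))"

definition linear_relays ::
  "nat \<Rightarrow> (nat \<Rightarrow> nat \<Rightarrow> (nat \<Rightarrow> real) \<Rightarrow> real) \<Rightarrow> bool"
where
  "linear_relays L g \<longleftrightarrow>
     (\<forall>i\<in>{1..L}. \<forall>t. \<exists>c. \<forall>y. g i t y = (\<Sum>k<t. c k * y k))"

definition linear_controller ::
  "nat \<Rightarrow> (nat \<Rightarrow> (nat \<Rightarrow> nat \<Rightarrow> real) \<Rightarrow> real) \<Rightarrow> bool"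
where
  "linear_controller L \<pi> \<longleftrightarrow>
     (\<forall>t. \<exists>d. \<forall>r. \<pi> t r = (\<Sum>i=1..L. \<Sum>k\<le>t. d i k * r i k))"

text \<open>
  The processes \<open>X, U, Se, Y, Sr, R\<close> are the trajectories of the plant controlled over the
  parallel network with encoder \<open>f\<close>, relays \<open>g\<close> and controller \<open>\<pi>\<close>. A finite history such as
  \<open>X\<^sub>0, \<dots>, X\<^sub>t\<close> is passed to a policy as a function restricted to its index set. For causal
  policies the equations determine the processes recursively. The network is not used at
  time \<open>0\<close>, which precedes the first transmission period \<open>{1, 2}\<close>.
\<close>

definition closed_loop ::
  "'w measure \<Rightarrow> real \<Rightarrow> real \<Rightarrow> nat \<Rightarrow>
   ('w \<Rightarrow> real) \<Rightarrow> (nat \<Rightarrow> 'w \<Rightarrow> real) \<Rightarrow>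
   (nat \<Rightarrow> nat \<Rightarrow> 'w \<Rightarrow> real) \<Rightarrow> (nat \<Rightarrow> nat \<Rightarrow> 'w \<Rightarrow> real) \<Rightarrow>
   (nat \<Rightarrow> (nat \<Rightarrow> real) \<Rightarrow> (nat \<Rightarrow> real) \<Rightarrow> real) \<Rightarrow>
   (nat \<Rightarrow> nat \<Rightarrow> (nat \<Rightarrow> real) \<Rightarrow> real) \<Rightarrow>
   (nat \<Rightarrow> (nat \<Rightarrow> nat \<Rightarrow> real) \<Rightarrow> real) \<Rightarrow>
   (nat \<Rightarrow> 'w \<Rightarrow> real) \<Rightarrow> (nat \<Rightarrow> 'w \<Rightarrow> real) \<Rightarrow> (nat \<Rightarrow> 'w \<Rightarrow> real) \<Rightarrow>
   (nat \<Rightarrow> nat \<Rightarrow> 'w \<Rightarrow> real) \<Rightarrow> (nat \<Rightarrow> nat \<Rightarrow> 'w \<Rightarrow> real) \<Rightarrow>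
   (nat \<Rightarrow> nat \<Rightarrow> 'w \<Rightarrow> real) \<Rightarrow> bool"
where
  "closed_loop M lam B L X0 W Zr Zd f g \<pi> X U Se Y Sr R \<longleftrightarrow>
     (\<forall>\<omega>\<in>space M.
        X 0 \<omega> = X0 \<omega> \<and>
        (\<forall>t.
           X (Suc t) \<omega> = lam * X t \<omega> + B * U t \<omega> + W t \<omega> \<and>
           U t \<omega> = \<pi> t (\<lambda>i\<in>{1..L}. \<lambda>k\<in>{..t}. R i k \<omega>) \<and>
           Se t \<omega> = (if odd t then f t (\<lambda>k\<in>{..t}. X k \<omega>) (\<lambda>k\<in>{..<t}. U k \<omega>) else 0) \<and>
           (\<forall>i\<in>{1..L}.
              Y i t \<omega> = (if odd t then Se t \<omega> + Zr i t \<omega> else 0) \<and>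
              Sr i t \<omega> = (if even t \<and> t > 0 then g i t (\<lambda>k\<in>{..<t}. Y i k \<omega>) else 0) \<and>
              R i t \<omega> = (if even t \<and> t > 0 then Sr i t \<omega> + Zd i t \<omega> else 0))))"

text \<open>Integrability is stated separately since the Bochner integral of a non-integrable
  function is \<open>0\<close>.\<close>

definition has_power :: "'w measure \<Rightarrow> ('w \<Rightarrow> real) \<Rightarrow> real \<Rightarrow> bool" where
  "has_power M S p \<longleftrightarrow>
     integrable M (\<lambda>\<omega>. (S \<omega>)\<^sup>2) \<and> (\<integral>\<omega>. (S \<omega>)\<^sup>2 \<partial>M) = p"

definition mean_square_stable :: "'w measure \<Rightarrow> (nat \<Rightarrow> 'w \<Rightarrow> real) \<Rightarrow> bool" where
  "mean_square_stable M X \<longleftrightarrow>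
     (\<exists>C. \<forall>t. integrable M (\<lambda>\<omega>. (X t \<omega>)\<^sup>2) \<and> (\<integral>\<omega>. (X t \<omega>)\<^sup>2 \<partial>M) < C)"

end

(* The encoder sends the rescaled state, every relay rescales what it heard, and the
   controller subtracts the linear least-squares estimate of the state. The maximal-ratio
   combination of the L relay signals has signal-to-noise ratio S, the sum in the hypothesis,
   so over one period of two steps the second moment of the state obeys
     alpha (t + 2) = lam^4 / (1 + S) * alpha t + (lam^2 + 1) * varW,
   which is a contraction exactly when lam^4 < 1 + S. Only second moments and orthogonality in
   L^2 enter, so X0 need be neither Gaussian nor centred. *)

theory Submission
  imports Defs
begin

section \<open>Orthogonality in mean square\<close>

text \<open>Membership in L^2. Measurability is listed separately because measurability of the
  square does not imply that of \<open>V\<close>.\<close>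

definition square_int :: "'w measure \<Rightarrow> ('w \<Rightarrow> real) \<Rightarrow> bool" where
  "square_int M V \<longleftrightarrow> V \<in> borel_measurable M \<and> integrable M (\<lambda>x. (V x)\<^sup>2)"

text \<open>Uncentred inner product zero, not covariance zero: a nonzero mean of \<open>X0\<close>
  then does no harm, since all later noise is centred.\<close>

definition perp :: "'w measure \<Rightarrow> ('w \<Rightarrow> real) \<Rightarrow> ('w \<Rightarrow> real) \<Rightarrow> bool" where
  "perp M V Z \<longleftrightarrow> (\<integral>x. V x * Z x \<partial>M) = 0"

definition moment2 :: "'w measure \<Rightarrow> ('w \<Rightarrow> real) \<Rightarrow> real" where
  "moment2 M V = (\<integral>x. (V x)\<^sup>2 \<partial>M)"

text \<open>The product is dominated by the integrable sum of the two squares. This makes the inner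
  product additive, as \<open>perp_add\<close>, \<open>perp_sum\<close> and
  \<open>moment2_add\<close> require.\<close>

lemma square_int_mult_integrable:
  assumes "square_int M V" "square_int M Z"
  shows "integrable M (\<lambda>x. V x * Z x)"
proof (rule Bochner_Integration.integrable_bound[where f = "\<lambda>x. (V x)\<^sup>2 + (Z x)\<^sup>2"])
  show "integrable M (\<lambda>x. (V x)\<^sup>2 + (Z x)\<^sup>2)" "(\<lambda>x. V x * Z x) \<in> borel_measurable M"
    using assms by (auto simp: square_int_def)
  have "\<bar>v * z\<bar> \<le> v\<^sup>2 + z\<^sup>2" for v z :: real
  proof -
    have "2 * (\<bar>v\<bar> * \<bar>z\<bar>) \<le> v\<^sup>2 + z\<^sup>2"
      using sum_squares_bound[of "\<bar>v\<bar>" "\<bar>z\<bar>"] by simp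
    moreover have "0 \<le> \<bar>v\<bar> * \<bar>z\<bar>" by simp
    ultimately show ?thesis by (simp only: abs_mult)
  qed
  then show "AE x in M. norm (V x * Z x) \<le> norm ((V x)\<^sup>2 + (Z x)\<^sup>2)"
    by (simp add: real_norm_def)
qed

lemma square_int_cmult:
  assumes "square_int M V"
  shows "square_int M (\<lambda>x. c * V x)"
  using assms by (auto simp: square_int_def power_mult_distrib)

lemma square_int_add:
  assumes "square_int M V" "square_int M Z"
  shows "square_int M (\<lambda>x. V x + Z x)"
proof -
  have "integrable M (\<lambda>x. (V x)\<^sup>2 + (Z x)\<^sup>2 + 2 * (V x * Z x))"
    using assms square_int_mult_integrable[OF assms] by (auto simp: square_int_def)
  then have "integrable M (\<lambda>x. (V x + Z x)\<^sup>2)"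
    by (simp add: power2_sum mult.assoc)
  then show ?thesis
    using assms by (auto simp: square_int_def)
qed

lemma square_int_sum:
  assumes "finite I" "\<And>i. i \<in> I \<Longrightarrow> square_int M (V i)"
  shows "square_int M (\<lambda>x. \<Sum>i\<in>I. V i x)"
  using assms
proof (induction I rule: finite_induct)
  case empty
  then show ?case by (simp add: square_int_def)
next
  case (insert i I)
  then show ?case by (simp add: square_int_add)
qed

lemma perp_commute: "perp M V Z \<longleftrightarrow> perp M Z V"
  by (simp add: perp_def mult.commute)

lemma perp_cmult:
  assumes "perp M V Z"
  shows "perp M (\<lambda>x. c * V x) Z"
  using assms by (simp add: perp_def mult.assoc)

lemma perp_add:
  assumes "square_int M V" "square_int M V'" "square_int M Z" "perp M V Z" "perp M V' Z"
  shows "perp M (\<lambda>x. V x + V' x) Z"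
  using assms by (simp add: perp_def distrib_right square_int_mult_integrable)

lemma perp_sum:
  assumes "\<And>i. i \<in> I \<Longrightarrow> square_int M (V i)" "square_int M Z"
    and "\<And>i. i \<in> I \<Longrightarrow> perp M (V i) Z"
  shows "perp M (\<lambda>x. \<Sum>i\<in>I. V i x) Z"
  using assms by (simp add: perp_def sum_distrib_right square_int_mult_integrable)

lemma moment2_cmult: "moment2 M (\<lambda>x. c * V x) = c\<^sup>2 * moment2 M V"
  by (simp add: moment2_def power_mult_distrib)

text \<open>Pythagoras in L^2: the cross term is twice the inner product.\<close>

lemma moment2_add:
  assumes "square_int M V" "square_int M Z" "perp M V Z"
  shows "moment2 M (\<lambda>x. V x + Z x) = moment2 M V + moment2 M Z"
proof -
  have "moment2 M (\<lambda>x. V x + Z x) = (\<integral>x. (V x)\<^sup>2 + (Z x)\<^sup>2 + 2 * (V x * Z x) \<partial>M)"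
    by (simp add: moment2_def power2_sum mult.assoc)
  also have "\<dots> = moment2 M V + moment2 M Z + 2 * (\<integral>x. V x * Z x \<partial>M)"
    using assms square_int_mult_integrable[OF assms(1,2)]
    by (simp add: square_int_def moment2_def)
  finally show ?thesis
    using assms(3) by (simp add: perp_def)
qed

lemma moment2_sum:
  assumes "finite I" "\<And>i. i \<in> I \<Longrightarrow> square_int M (V i)"
    and "\<And>i j. i \<in> I \<Longrightarrow> j \<in> I \<Longrightarrow> i \<noteq> j \<Longrightarrow> perp M (V i) (V j)"
  shows "moment2 M (\<lambda>x. \<Sum>i\<in>I. V i x) = (\<Sum>i\<in>I. moment2 M (V i))"
  using assms
proof (induction I rule: finite_induct)
  case empty
  then show ?case by (simp add: moment2_def)
next
  case (insert i I)
  have "perp M (V i) (\<lambda>x. \<Sum>j\<in>I. V j x)"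
    unfolding perp_commute[of M "V i"]
    using insert by (intro perp_sum) auto
  then show ?case
    using insert by (simp add: moment2_add square_int_sum)
qed

lemma (in prob_space) gaussian_square_int:
  assumes "gaussian M Z v"
  shows "square_int M Z" "integrable M Z" "(\<integral>x. Z x \<partial>M) = 0" "moment2 M Z = v"
proof -
  have v: "v > 0" and D: "distributed M lborel Z (normal_density 0 (sqrt v))"
    using assms by (auto simp: gaussian_def)
  show m: "(\<integral>x. Z x \<partial>M) = 0"
    using normal_distributed_expectation[OF _ D] v by simp
  \<comment> \<open>The variance is taken about the mean; it equals the second moment because the
    mean is 0.\<close>
  show "moment2 M Z = v"
    using normal_distributed_variance[OF _ D] v m by (simp add: moment2_def)
  have k: "integrable M (\<lambda>x. Z x ^ k)" for k
    using distributed_integrable[OF D, of "\<lambda>x. x ^ k"] integrable_normal_moment[of "sqrt v" 0 k] v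
    by simp
  show "integrable M Z"
    using k[of 1] by simp
  show "square_int M Z"
    using k[of 2] distributed_measurable[OF D] by (simp add: square_int_def)
qed

section \<open>The closed loop\<close>

fun source_time :: "source \<Rightarrow> nat" where
  "source_time Initial = 0"
| "source_time (Process t) = t"
| "source_time (Relay_Noise i t) = t"
| "source_time (Dest_Noise i t) = t"

lemma Process_in_sources: "Process t \<in> sources L"
  by (auto simp: sources_def)

lemma Noise_in_sources:
  assumes "i \<in> {1..L}"
  shows "Relay_Noise i t \<in> sources L" "Dest_Noise i t \<in> sources L"
  using assms unfolding sources_def by blast+

locale parallel_network = prob_space M
  for M :: "'w measure" +
  fixes lam B :: real and L :: nat and P_S varW :: real
    and P_r N_r N_d :: "nat \<Rightarrow> real"
    and X0 :: "'w \<Rightarrow> real" and W :: "nat \<Rightarrow> 'w \<Rightarrow> real"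
    and Zr Zd :: "nat \<Rightarrow> nat \<Rightarrow> 'w \<Rightarrow> real"
  assumes B: "B \<noteq> 0"
    and X0: "integrable M (\<lambda>\<omega>. (X0 \<omega>)\<^sup>2)"
    and W: "\<And>t. gaussian M (W t) varW"
    and Zr: "\<And>i t. i \<in> {1..L} \<Longrightarrow> gaussian M (Zr i t) (N_r i)"
    and Zd: "\<And>i t. i \<in> {1..L} \<Longrightarrow> gaussian M (Zd i t) (N_d i)"
    and indep: "indep_vars (\<lambda>_. borel) (source_var X0 W Zr Zd) (sources L)"
    and P_S: "P_S \<ge> 0"
    and P_r: "\<And>i. i \<in> {1..L} \<Longrightarrow> P_r i \<ge> 0"
begin

abbreviation src :: "source \<Rightarrow> 'w \<Rightarrow> real" where
  "src \<equiv> source_var X0 W Zr Zd"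

lemma noise_pos:
  shows "varW > 0" and "i \<in> {1..L} \<Longrightarrow> N_r i > 0" and "i \<in> {1..L} \<Longrightarrow> N_d i > 0"
  using W[of 0] Zr[of i 0] Zd[of i 0] by (auto simp: gaussian_def)

lemma src_gaussian:
  assumes "s \<in> sources L" "s \<noteq> Initial"
  shows "\<exists>v. gaussian M (src s) v"
proof (cases s)
  case (Process t)
  then show ?thesis using W by auto
next
  case (Relay_Noise i t)
  then have "i \<in> {1..L}" using assms by (auto simp: sources_def)
  from Zr[OF this] show ?thesis using Relay_Noise by auto
next
  case (Dest_Noise i t)
  then have "i \<in> {1..L}" using assms by (auto simp: sources_def)
  from Zd[OF this] show ?thesis using Dest_Noise by auto
qed (use assms in simp)

lemma src_square_int:
  assumes "s \<in> sources L"
  shows "square_int M (src s)"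
proof (cases "s = Initial")
  case True
  \<comment> \<open>Measurability of \<open>X0\<close> is contained in
    \<open>indep_vars\<close>.\<close>
  have "src s \<in> borel_measurable M"
    using indep assms by (auto simp: indep_vars_def)
  with True X0 show ?thesis
    by (simp add: square_int_def)
next
  case False
  then show ?thesis
    using src_gaussian[OF assms] gaussian_square_int(1) by blast
qed

text \<open>Independence factors the expectation of the product, and the factor of \<open>s'\<close>
  vanishes because every source other than \<open>Initial\<close> is centred.\<close>

lemma src_perp:
  assumes "s \<in> sources L" "s' \<in> sources L" "s \<noteq> s'" "s' \<noteq> Initial"
  shows "perp M (src s) (src s')"
proof -
  \<comment> \<open>Multiplying by the constant 1 turns square integrability into
    integrability.\<close>
  have 1: "square_int M (\<lambda>_. 1)"
    by (simp add: square_int_def)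
  have "indep_vars (\<lambda>_. borel) src {s, s'}"
    using indep_vars_subset[OF indep] assms by auto
  moreover have int: "integrable M (src r)" if "r \<in> sources L" for r
    using square_int_mult_integrable[OF src_square_int[OF that] 1] by simp
  ultimately have "(\<integral>x. (\<Prod>r\<in>{s, s'}. src r x) \<partial>M) = (\<Prod>r\<in>{s, s'}. \<integral>x. src r x \<partial>M)"
    using assms by (intro indep_vars_lebesgue_integral) auto
  moreover have "(\<integral>x. src s' x \<partial>M) = 0"
    using src_gaussian[OF assms(2,4)] gaussian_square_int(3) by blast
  ultimately show ?thesis
    using assms(3) by (simp add: perp_def)
qed

section \<open>Gains, second-moment recursion and closed-loop trajectory\<close>

definition relay_gain :: "nat \<Rightarrow> real" where
  "relay_gain i = sqrt (2 * P_r i / (2 * P_S + N_r i))"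

text \<open>Variance of the noise that link \<open>i\<close> delivers: the relay noise after
  amplification plus the destination noise.\<close>

definition link_noise :: "nat \<Rightarrow> real" where
  "link_noise i = (relay_gain i)\<^sup>2 * N_r i + N_d i"

definition snr :: "nat \<Rightarrow> real" where
  "snr i = 4 * P_S * P_r i / (2 * P_S * N_d i + 2 * P_r i * N_r i + N_d i * N_r i)"

definition total_snr :: real where
  "total_snr = (\<Sum>i=1..L. snr i)"

text \<open>The second moments of \<open>state\<close>, as \<open>moment2_state\<close> shows. They
  are computed in advance from deterministic data, so the gains below can depend on them without
  circularity.\<close>

fun alpha :: "nat \<Rightarrow> real" where
  "alpha 0 = moment2 M X0"
| "alpha (Suc 0) = lam\<^sup>2 * alpha 0 + varW"
| "alpha (Suc (Suc t)) =
     (if odd t then lam ^ 4 / (1 + total_snr) * alpha t + (lam\<^sup>2 + 1) * varW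
      else lam\<^sup>2 * alpha (Suc t) + varW)"

definition enc_gain :: "nat \<Rightarrow> real" where
  "enc_gain t = sqrt (2 * P_S / alpha t)"

text \<open>The maximal-ratio weights: the least-squares estimate of the state \<open>X\<^sub>t\<close> from the relay
  signals of time \<open>t + 1\<close> is \<open>\<Sum>i. weight i t * R i (t + 1)\<close>.\<close>

definition weight :: "nat \<Rightarrow> nat \<Rightarrow> real" where
  "weight i t = alpha t * relay_gain i * enc_gain t / (link_noise i * (1 + total_snr))"

text \<open>The relay signal of time \<open>t + 1\<close>. The state value is a parameter
  \<open>x\<close> because the recursion of \<open>state\<close> itself calls this function.\<close>

definition received :: "nat \<Rightarrow> nat \<Rightarrow> real \<Rightarrow> 'w \<Rightarrow> real" where
  "received i t x \<omega> = relay_gain i * (enc_gain t * x + Zr i t \<omega>) + Zd i (Suc t) \<omega>"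

text \<open>The plant with the control already substituted. The control at the even time
  \<open>t + 1\<close> knows an estimate of the state at \<open>t\<close>, which enters the state at
  \<open>t + 2\<close> with factor \<open>lam\<^sup>2\<close>; hence that factor on the
  estimate.\<close>

fun state :: "nat \<Rightarrow> 'w \<Rightarrow> real" where
  "state 0 \<omega> = X0 \<omega>"
| "state (Suc 0) \<omega> = lam * X0 \<omega> + W 0 \<omega>"
| "state (Suc (Suc t)) \<omega> = lam * state (Suc t) \<omega> + W (Suc t) \<omega> -
     (if odd t then lam\<^sup>2 * (\<Sum>i=1..L. weight i t * received i t (state t \<omega>) \<omega>) else 0)"

section \<open>Algebra of the gains and signal-to-noise ratios\<close>

lemma relay_gain_sq:
  assumes "i \<in> {1..L}"
  shows "(relay_gain i)\<^sup>2 = 2 * P_r i / (2 * P_S + N_r i)"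
  using P_S P_r[OF assms] noise_pos(2)[OF assms] by (simp add: relay_gain_def)

lemma link_noise_pos:
  assumes "i \<in> {1..L}"
  shows "link_noise i > 0"
  using noise_pos(2,3)[OF assms] by (simp add: link_noise_def add_nonneg_pos)

text \<open>Signal power over noise power on link \<open>i\<close>. Clearing the common denominator
  \<open>2 * P_S + N_r i\<close> yields the summand of the hypothesis.\<close>

lemma snr_eq:
  assumes "i \<in> {1..L}"
  shows "snr i = (relay_gain i)\<^sup>2 * (2 * P_S) / link_noise i"
proof -
  have p: "2 * P_S + N_r i > 0"
    using P_S noise_pos(2)[OF assms] by simp
  have "link_noise i =
      (2 * P_S * N_d i + 2 * P_r i * N_r i + N_d i * N_r i) / (2 * P_S + N_r i)"
    using p by (simp add: link_noise_def relay_gain_sq[OF assms] field_simps)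
  then show ?thesis
    using p by (simp add: snr_def relay_gain_sq[OF assms])
qed

lemma total_snr_nonneg: "total_snr \<ge> 0"
  unfolding total_snr_def
proof (rule sum_nonneg)
  fix i assume i: "i \<in> {1..L}"
  show "snr i \<ge> 0"
    using link_noise_pos[OF i] P_S by (simp add: snr_eq[OF i])
qed

lemma alpha_nonneg: "alpha t \<ge> 0"
proof (induction t rule: alpha.induct)
  case 1
  then show ?case by (simp add: moment2_def)
next
  case 2
  then show ?case using noise_pos(1) by simp
next
  case (3 t)
  then show ?case using noise_pos(1) total_snr_nonneg by simp
qed

text \<open>Each step adds at least the process noise variance, whatever \<open>alpha 0\<close> is.
  This makes the division in \<open>enc_gain\<close> genuine at odd times.\<close>

lemma alpha_pos: "alpha (Suc t) > 0"
proof (cases t)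
  case 0
  then show ?thesis
    using alpha_nonneg[of 0] noise_pos(1) by (simp add: add_nonneg_pos del: alpha.simps(1))
next
  case (Suc s)
  have "(lam\<^sup>2 + 1) * varW > 0"
    using noise_pos(1) by (intro mult_pos_pos) (simp_all add: add_nonneg_pos)
  then show ?thesis
    using Suc alpha_nonneg noise_pos(1) total_snr_nonneg by (simp add: add_nonneg_pos)
qed

lemma enc_gain_sq:
  assumes "odd t"
  shows "(enc_gain t)\<^sup>2 * alpha t = 2 * P_S"
proof -
  have "alpha t > 0"
    using assms alpha_pos by (cases t) auto
  then show ?thesis
    using P_S by (simp add: enc_gain_def)
qed

text \<open>Summed over the links this gives \<open>total_snr / (1 + total_snr)\<close>, the
  shrinkage factor of the least-squares estimate.\<close>

lemma weight_gain:
  assumes "odd t" "i \<in> {1..L}"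
  shows "weight i t * (relay_gain i * enc_gain t) = snr i / (1 + total_snr)"
proof -
  have "weight i t * (relay_gain i * enc_gain t) =
      (relay_gain i)\<^sup>2 * ((enc_gain t)\<^sup>2 * alpha t) / (link_noise i * (1 + total_snr))"
    by (simp add: weight_def power2_eq_square mult_ac)
  then show ?thesis
    by (simp add: enc_gain_sq[OF assms(1)] snr_eq[OF assms(2)])
qed

text \<open>Second factor of the error computation: the noise that link \<open>i\<close> leaves in
  the estimate, again reduced to \<open>snr i\<close> by the power normalisation of the
  encoder.\<close>

lemma weight_noise:
  assumes "odd t" "i \<in> {1..L}"
  shows "(weight i t)\<^sup>2 * link_noise i = alpha t * snr i / (1 + total_snr)\<^sup>2"
proof -
  have "(weight i t)\<^sup>2 * link_noise i =
      alpha t * ((relay_gain i)\<^sup>2 * ((enc_gain t)\<^sup>2 * alpha t)) /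
      (link_noise i * (1 + total_snr)\<^sup>2)"
    using link_noise_pos[OF assms(2)]
    by (simp add: weight_def power2_eq_square mult_ac)
  then show ?thesis
    by (simp add: enc_gain_sq[OF assms(1)] snr_eq[OF assms(2)])
qed

section \<open>One period of the closed loop, split into signal and noise\<close>

definition link_part :: "nat \<Rightarrow> nat \<Rightarrow> 'w \<Rightarrow> real" where
  "link_part t i \<omega> = weight i t * (relay_gain i * Zr i t \<omega> + Zd i (Suc t) \<omega>)"

lemma state_even:
  assumes "even t"
  shows "state (Suc t) \<omega> =
    lam * state t \<omega> + W t \<omega> - (if t = 0 then 0 else
      lam\<^sup>2 * (\<Sum>i=1..L. weight i (t - 1) * received i (t - 1) (state (t - 1) \<omega>) \<omega>))"
  using assms by (cases t) auto

text \<open>The factor 1 gives every summand the shape \<open>c * V\<close>, so the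
  \<open>cmult\<close> rules apply uniformly.\<close>

lemma state_odd:
  assumes "odd t"
  shows "state (Suc t) \<omega> = lam * state t \<omega> + 1 * W t \<omega>"
  using assms by (cases t) auto

text \<open>The estimate contains the fraction S / (1 + S) of the state, S being
  \<open>total_snr\<close>, so subtracting it leaves 1 / (1 + S). The right-nested sum lets
  Pythagoras split off one term at a time.\<close>

lemma state_period:
  assumes "odd t"
  shows "state (Suc (Suc t)) \<omega> = lam\<^sup>2 / (1 + total_snr) * state t \<omega> +
    (lam * W t \<omega> + (1 * W (Suc t) \<omega> + (- (lam\<^sup>2)) * (\<Sum>i=1..L. link_part t i \<omega>)))"
proof -
  have "(\<Sum>i=1..L. weight i t * received i t (state t \<omega>) \<omega>) =
      (\<Sum>i=1..L. snr i / (1 + total_snr) * state t \<omega> + link_part t i \<omega>)"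
  proof (rule sum.cong[OF refl])
    fix i assume i: "i \<in> {1..L}"
    have "weight i t * received i t (state t \<omega>) \<omega> =
        weight i t * (relay_gain i * enc_gain t) * state t \<omega> + link_part t i \<omega>"
      by (simp add: received_def link_part_def algebra_simps)
    then show "weight i t * received i t (state t \<omega>) \<omega> =
        snr i / (1 + total_snr) * state t \<omega> + link_part t i \<omega>"
      by (simp only: weight_gain[OF assms i])
  qed
  also have "\<dots> = total_snr / (1 + total_snr) * state t \<omega> + (\<Sum>i=1..L. link_part t i \<omega>)"
    by (simp add: sum.distrib total_snr_def sum_distrib_right sum_divide_distrib)
  also have "total_snr / (1 + total_snr) = 1 - 1 / (1 + total_snr)"
    using total_snr_nonneg by (simp add: field_simps)
  finally have estimate: "(\<Sum>i=1..L. weight i t * received i t (state t \<omega>) \<omega>) =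
      (1 - 1 / (1 + total_snr)) * state t \<omega> + (\<Sum>i=1..L. link_part t i \<omega>)" .
  have "state (Suc (Suc t)) \<omega> = lam * (lam * state t \<omega> + W t \<omega>) + W (Suc t) \<omega> -
      lam\<^sup>2 * (\<Sum>i=1..L. weight i t * received i t (state t \<omega>) \<omega>)"
    using assms state_odd[OF assms, of \<omega>] by simp
  then show ?thesis
    unfolding estimate by (simp add: algebra_simps power2_eq_square)
qed

section \<open>Orthogonality and second moment of the link noise\<close>

lemma link_part_square_int:
  assumes "i \<in> {1..L}"
  shows "square_int M (link_part t i)"
  unfolding link_part_def
  using src_square_int[OF Noise_in_sources(1)[OF assms, of t]]
    src_square_int[OF Noise_in_sources(2)[OF assms, of "Suc t"]]
  by (auto intro!: square_int_cmult square_int_add)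

lemma link_part_perp:
  assumes "i \<in> {1..L}" "s \<in> sources L" "s \<noteq> Initial"
    and "s \<noteq> Relay_Noise i t" "s \<noteq> Dest_Noise i (Suc t)"
  shows "perp M (link_part t i) (src s)"
  unfolding link_part_def
  using src_square_int[OF Noise_in_sources(1)[OF assms(1), of t]]
    src_square_int[OF Noise_in_sources(2)[OF assms(1), of "Suc t"]]
    src_perp[OF Noise_in_sources(1)[OF assms(1), of t] assms(2)]
    src_perp[OF Noise_in_sources(2)[OF assms(1), of "Suc t"] assms(2)]
    src_square_int[OF assms(2)] assms(3-)
  by (auto intro!: perp_cmult perp_add square_int_cmult)

text \<open>Distinct links share no source. Link \<open>j\<close> is expanded into its two noises,
  each orthogonal to all of \<open>link_part t i\<close>, and recombined by linearity.\<close>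

lemma link_part_perp_link_part:
  assumes "i \<in> {1..L}" "j \<in> {1..L}" "i \<noteq> j"
  shows "perp M (link_part t i) (link_part t j)"
proof -
  have "perp M (src (Relay_Noise j t)) (link_part t i)"
    "perp M (src (Dest_Noise j (Suc t))) (link_part t i)"
    unfolding perp_commute[of M _ "link_part t i"]
    using assms by (auto intro!: link_part_perp Noise_in_sources simp del: source_var.simps)
  then have "perp M (\<lambda>\<omega>. weight j t * (relay_gain j * Zr j t \<omega> + Zd j (Suc t) \<omega>)) (link_part t i)"
    using src_square_int[OF Noise_in_sources(1)[OF assms(2), of t]]
      src_square_int[OF Noise_in_sources(2)[OF assms(2), of "Suc t"]]
      link_part_square_int[OF assms(1)]
    by (auto intro!: perp_cmult perp_add square_int_cmult)
  then show ?thesis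
    unfolding perp_commute[of M "link_part t i"] by (simp add: link_part_def[abs_def])
qed

lemma moment2_link_part:
  assumes "odd t" "i \<in> {1..L}"
  shows "moment2 M (link_part t i) = alpha t * snr i / (1 + total_snr)\<^sup>2"
proof -
  have "perp M (src (Relay_Noise i t)) (src (Dest_Noise i (Suc t)))"
    using assms by (intro src_perp Noise_in_sources) auto
  then have "moment2 M (link_part t i) = (weight i t)\<^sup>2 * link_noise i"
    using gaussian_square_int[OF Zr[OF assms(2), of t]]
      gaussian_square_int[OF Zd[OF assms(2), of "Suc t"]]
    by (simp add: link_part_def[abs_def] moment2_cmult moment2_add square_int_cmult perp_cmult
        link_noise_def)
  then show ?thesis
    by (simp add: weight_noise[OF assms])
qed

definition links :: "nat \<Rightarrow> 'w \<Rightarrow> real" where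
  "links t \<omega> = (\<Sum>i=1..L. link_part t i \<omega>)"

lemma links_square_int: "square_int M (links t)"
  unfolding links_def[abs_def] using link_part_square_int by (intro square_int_sum) auto

lemma links_perp:
  assumes "s \<in> sources L" "s \<noteq> Initial"
    and "\<And>i. s \<noteq> Relay_Noise i t" "\<And>i. s \<noteq> Dest_Noise i (Suc t)"
  shows "perp M (links t) (src s)"
  unfolding links_def[abs_def]
  using assms src_square_int by (intro perp_sum link_part_square_int link_part_perp) auto

lemma moment2_links:
  assumes "odd t"
  shows "moment2 M (links t) = alpha t * total_snr / (1 + total_snr)\<^sup>2"
  unfolding links_def[abs_def]
  using assms
  by (subst moment2_sum)
    (simp_all add: link_part_square_int link_part_perp_link_part moment2_link_part
      total_snr_def sum_distrib_left sum_divide_distrib)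

section \<open>Causality and second moments of the state\<close>

lemma W_square_int: "square_int M (W t)"
  using gaussian_square_int(1)[OF W] .

lemma state_fun_period:
  assumes "odd t"
  shows "state (Suc (Suc t)) = (\<lambda>\<omega>. lam\<^sup>2 / (1 + total_snr) * state t \<omega> +
    (lam * W t \<omega> + (1 * W (Suc t) \<omega> + (- (lam\<^sup>2)) * links t \<omega>)))"
  using state_period[OF assms] by (auto simp: links_def)

lemma state_fun_odd:
  assumes "odd t"
  shows "state (Suc t) = (\<lambda>\<omega>. lam * state t \<omega> + 1 * W t \<omega>)"
  using state_odd[OF assms] by auto

lemma state_fun_Suc_0: "state (Suc 0) = (\<lambda>\<omega>. lam * state 0 \<omega> + 1 * W 0 \<omega>)"
  by auto

text \<open>Odd times advance by a whole period: the control at \<open>t + 1\<close> depends on the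
  state at \<open>t\<close>, so a single step from \<open>t + 1\<close> would have correlated
  summands, whereas those of \<open>state_fun_period\<close> are orthogonal.\<close>

lemma state_induct [case_names init first second period]:
  assumes "P 0" "P 0 \<Longrightarrow> P (Suc 0)"
    and "\<And>t. odd t \<Longrightarrow> P t \<Longrightarrow> P (Suc t)"
    and "\<And>t. odd t \<Longrightarrow> P t \<Longrightarrow> P (Suc (Suc t))"
  shows "P t"
\<comment> \<open>The recursion of \<open>alpha\<close> refers back by two steps or by one according
  to parity, which are exactly the induction hypotheses wanted.\<close>
proof (induction t rule: alpha.induct)
  case (3 t)
  then show ?case using assms(3)[of "Suc t"] assms(4)[of t] by (cases "odd t") auto
qed (use assms in auto)

lemma state_square_int: "square_int M (state t)"
proof (induction t rule: state_induct)
  case init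
  have "Initial \<in> sources L" by (simp add: sources_def)
  from src_square_int[OF this] show ?case by (simp add: square_int_def)
next
  case first
  then show ?case
    unfolding state_fun_Suc_0 by (intro square_int_add square_int_cmult W_square_int)
next
  case (second t)
  then show ?case
    unfolding state_fun_odd[OF second(1)] by (intro square_int_add square_int_cmult W_square_int)
next
  case (period t)
  then show ?case
    unfolding state_fun_period[OF period(1)]
    by (intro square_int_add square_int_cmult W_square_int links_square_int)
qed

lemma W_perp:
  assumes "s \<in> sources L" "s \<noteq> Initial" "s \<noteq> Process t"
  shows "perp M (W t) (src s)"
  using src_perp[OF Process_in_sources assms(1), of t] assms by simp

text \<open>Causality: the state at \<open>t\<close> is a combination of \<open>X0\<close> and of
  noises whose \<open>source_time\<close> is strictly below \<open>t\<close>.\<close>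

lemma state_perp:
  assumes "s \<in> sources L" "s \<noteq> Initial" "t \<le> source_time s"
  shows "perp M (state t) (src s)"
  using assms(3)
proof (induction t rule: state_induct)
  case init
  have "Initial \<in> sources L" by (simp add: sources_def)
  from src_perp[OF this assms(1)] assms(2) show ?case
    by (simp add: perp_def)
next
  case first
  then have "s \<noteq> Process 0" by auto
  then show ?case
    unfolding state_fun_Suc_0 using first assms(1,2)
    by (intro perp_add perp_cmult square_int_cmult state_square_int W_square_int W_perp
        src_square_int) auto
next
  case (second t)
  then have "s \<noteq> Process t" by auto
  then show ?case
    unfolding state_fun_odd[OF second(1)] using second assms(1,2)
    by (intro perp_add perp_cmult square_int_cmult state_square_int W_square_int W_perp
        src_square_int) auto
next
  case (period t)
  \<comment> \<open>Noise entering during the period has time \<open>t\<close> or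
    \<open>t + 1\<close>, while \<open>s\<close> has time at least \<open>t + 2\<close>.\<close>
  then have "s \<noteq> Process t" "s \<noteq> Process (Suc t)"
    "\<And>i. s \<noteq> Relay_Noise i t" "\<And>i. s \<noteq> Dest_Noise i (Suc t)" by auto
  then show ?case
    unfolding state_fun_period[OF period(1)] using period assms(1,2)
    by (intro perp_add perp_cmult square_int_cmult square_int_add state_square_int W_square_int
        W_perp links_square_int links_perp src_square_int) auto
qed

lemma state_perp_W:
  assumes "t \<le> s"
  shows "perp M (state t) (W s)"
  using state_perp[OF Process_in_sources, of s t] assms by simp

text \<open>The relay noises date from \<open>t\<close> and the destination noises from
  \<open>t + 1\<close>, neither earlier than the state.\<close>

lemma state_perp_links: "perp M (state t) (links t)"
proof -
  have "perp M (link_part t i) (state t)" if i: "i \<in> {1..L}" for i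
  proof -
    have "perp M (Zr i t) (state t)" "perp M (Zd i (Suc t)) (state t)"
      unfolding perp_commute[of M _ "state t"]
      using state_perp[OF Noise_in_sources(1)[OF i], of t t]
        state_perp[OF Noise_in_sources(2)[OF i], of "Suc t" t] by simp_all
    then show ?thesis
      unfolding link_part_def[abs_def]
      using gaussian_square_int(1)[OF Zr[OF i]] gaussian_square_int(1)[OF Zd[OF i]]
      by (intro perp_cmult perp_add square_int_cmult state_square_int)
  qed
  then show ?thesis
    unfolding perp_commute[of M "state t"] links_def[abs_def]
    by (intro perp_sum link_part_square_int state_square_int)
qed

lemma moment2_state: "moment2 M (state t) = alpha t"
proof (induction t rule: state_induct)
  case init
  then show ?case by (simp add: moment2_def)
next
  case first
  have "moment2 M (state (Suc 0)) = lam\<^sup>2 * moment2 M (state 0) + 1\<^sup>2 * moment2 M (W 0)"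
    unfolding state_fun_Suc_0 moment2_cmult[symmetric]
    by (intro moment2_add square_int_cmult state_square_int W_square_int perp_cmult
        perp_commute[THEN iffD1, OF perp_cmult] perp_commute[THEN iffD1, OF state_perp_W]) simp
  then show ?case
    using first gaussian_square_int(4)[OF W] by (simp add: state_fun_Suc_0)
next
  case (second t)
  have "moment2 M (state (Suc t)) = lam\<^sup>2 * moment2 M (state t) + 1\<^sup>2 * moment2 M (W t)"
    unfolding state_fun_odd[OF second(1)] moment2_cmult[symmetric]
    by (intro moment2_add square_int_cmult state_square_int W_square_int perp_cmult
        perp_commute[THEN iffD1, OF perp_cmult] perp_commute[THEN iffD1, OF state_perp_W]) simp
  moreover have "alpha (Suc t) = lam\<^sup>2 * alpha t + varW"
    using second(1) by (cases t) auto
  ultimately show ?case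
    using second gaussian_square_int(4)[OF W] by simp
next
  case (period t)
  \<comment> \<open>\<open>T\<close> and \<open>V\<close> are the tails of the nested sum; each is
    orthogonal to the term in front of it.\<close>
  define T where "T = (\<lambda>\<omega>. 1 * W (Suc t) \<omega> + (- (lam\<^sup>2)) * links t \<omega>)"
  define V where "V = (\<lambda>\<omega>. lam * W t \<omega> + T \<omega>)"
  have state_eq: "state (Suc (Suc t)) = (\<lambda>\<omega>. lam\<^sup>2 / (1 + total_snr) * state t \<omega> + V \<omega>)"
    unfolding V_def T_def by (rule state_fun_period[OF period(1)])
  have sq: "square_int M T" "square_int M V"
    unfolding V_def T_def
    by (intro square_int_add square_int_cmult W_square_int links_square_int)+
  have pW: "perp M (W (Suc t)) (links t)" "perp M (links t) (W t)"
    using links_perp[OF Process_in_sources, of "Suc t" t] links_perp[OF Process_in_sources, of t t]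
    by (simp_all add: perp_commute[of M "W (Suc t)"])
  have "perp M (W (Suc t)) (W t)"
    using W_perp[OF Process_in_sources, of t "Suc t"] by simp
  then have "perp M T (W t)"
    unfolding T_def using pW
    by (intro perp_add perp_cmult square_int_cmult W_square_int links_square_int)
  then have p1: "perp M (W t) T"
    by (simp add: perp_commute[of M "W t"])
  have st: "perp M (W (Suc t)) (state t)" "perp M (W t) (state t)" "perp M (links t) (state t)"
    using state_perp_W[of t "Suc t"] state_perp_W[of t t] state_perp_links[of t]
    by (simp_all add: perp_commute[of M "state t"])
  have "perp M T (state t)"
    unfolding T_def
    by (intro perp_add perp_cmult square_int_cmult W_square_int links_square_int
        state_square_int st)
  then have p2: "perp M (state t) V"
    unfolding perp_commute[of M "state t"] V_def
    by (intro perp_add perp_cmult square_int_cmult sq W_square_int state_square_int st)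
  note p = p1 p2
  have "moment2 M T = 1\<^sup>2 * moment2 M (W (Suc t)) + (- (lam\<^sup>2))\<^sup>2 * moment2 M (links t)"
    unfolding T_def moment2_cmult[symmetric]
    by (intro moment2_add square_int_cmult W_square_int links_square_int perp_cmult
        perp_commute[THEN iffD1, OF perp_cmult] perp_commute[THEN iffD1, OF pW(1)])
  moreover have "moment2 M V = lam\<^sup>2 * moment2 M (W t) + moment2 M T"
    unfolding V_def moment2_cmult[symmetric]
    by (intro moment2_add square_int_cmult W_square_int sq perp_cmult p)
  moreover have "moment2 M (state (Suc (Suc t))) =
      (lam\<^sup>2 / (1 + total_snr))\<^sup>2 * moment2 M (state t) + moment2 M V"
    unfolding state_eq moment2_cmult[symmetric]
    by (intro moment2_add square_int_cmult state_square_int sq perp_cmult p)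
  ultimately have "moment2 M (state (Suc (Suc t))) =
      (lam\<^sup>2 / (1 + total_snr))\<^sup>2 * alpha t + (lam\<^sup>2 * varW +
        (varW + lam ^ 4 * (alpha t * total_snr / (1 + total_snr)\<^sup>2)))"
    using period gaussian_square_int(4)[OF W] moment2_links[OF period(1)] by simp
  \<comment> \<open>The unestimated part of the state contributes 1 and the link noise contributes S
    to the numerator; the resulting 1 + S cancels one power of the denominator.\<close>
  also have "\<dots> = lam ^ 4 * (1 + total_snr) / (1 + total_snr)\<^sup>2 * alpha t + (lam\<^sup>2 + 1) * varW"
    by (simp add: power_divide algebra_simps add_divide_distrib)
  also have "\<dots> = lam ^ 4 / (1 + total_snr) * alpha t + (lam\<^sup>2 + 1) * varW"
    using total_snr_nonneg by (simp add: power2_eq_square)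
  finally show ?case
    using period(1) by (simp del: state.simps)
qed

section \<open>Boundedness of the second moments\<close>

lemma alpha_bounded:
  assumes "lam ^ 4 < 1 + total_snr"
  shows "\<exists>C. \<forall>t. alpha t < C"
proof -
  define q where "q = lam ^ 4 / (1 + total_snr)"
  define k where "k = (lam\<^sup>2 + 1) * varW"
  \<comment> \<open>A bound above both the initial odd value and the fixed point of x -> q x + k is
    preserved by that map.\<close>
  define D where "D = max (alpha 1) (k / (1 - q))"
  have q: "0 \<le> q" "q < 1"
    using assms total_snr_nonneg by (auto simp: q_def)
  have D: "q * D + k \<le> D"
  proof -
    have "k / (1 - q) \<le> D" by (simp add: D_def)
    then have "k \<le> D * (1 - q)" using q by (simp add: pos_divide_le_eq)
    then show ?thesis by (simp add: algebra_simps)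
  qed
  have odd_le: "alpha (2 * n + 1) \<le> D" for n
  proof (induction n)
    case 0
    then show ?case by (simp add: D_def)
  next
    case (Suc n)
    have "alpha (2 * Suc n + 1) = q * alpha (2 * n + 1) + k"
      by (simp add: q_def k_def)
    also have "\<dots> \<le> q * D + k"
      using Suc q by (simp add: mult_left_mono)
    finally show ?case using D by simp
  qed
  have even_le: "alpha (2 * n + 2) \<le> lam\<^sup>2 * D + varW" for n
    using mult_left_mono[OF odd_le[of n], of "lam\<^sup>2"] by simp
  \<comment> \<open>Time 0 belongs to neither subsequence and gets its own term in the
    maximum.\<close>
  have "alpha t \<le> max (alpha 0) (max D (lam\<^sup>2 * D + varW))" for t
  proof (cases "t = 0 \<or> odd t")
    case True
    then show ?thesis
      using odd_le by (auto elim!: oddE simp: max.coboundedI2 max.coboundedI1 simp del: alpha.simps)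
  next
    case False
    then obtain n where "t = 2 * n + 2"
      by (metis evenE add_2_eq_Suc' mult_Suc_right not0_implies_Suc mult_0_right add.commute)
    then show ?thesis
      using even_le[of n] by (simp add: max.coboundedI2 del: alpha.simps)
  qed
  then have "alpha t < max (alpha 0) (max D (lam\<^sup>2 * D + varW)) + 1" for t
    using less_add_one le_less_trans by blast
  then show ?thesis
    by blast
qed

section \<open>Linear policies realising the trajectory\<close>

lemma linear_scheme:
  assumes "lam ^ 4 < 1 + total_snr"
  shows "\<exists>f g \<pi>. linear_encoder f \<and> linear_relays L g \<and> linear_controller L \<pi> \<and>
           (\<exists>X U Se Y Sr R.
              closed_loop M lam B L X0 W Zr Zd f g \<pi> X U Se Y Sr R \<and>
              (\<forall>t. odd t \<longrightarrow> has_power M (Se t) (2 * P_S)) \<and>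
              (\<forall>i\<in>{1..L}. \<forall>t. even t \<and> t > 0 \<longrightarrow> has_power M (Sr i t) (2 * P_r i)) \<and>
              mean_square_stable M X)"
proof -
  define f :: "nat \<Rightarrow> (nat \<Rightarrow> real) \<Rightarrow> (nat \<Rightarrow> real) \<Rightarrow> real"
    where "f = (\<lambda>t x u. enc_gain t * x t)"
  \<comment> \<open>At time 0 the relay history is empty, so linearity forces the value 0.\<close>
  define g :: "nat \<Rightarrow> nat \<Rightarrow> (nat \<Rightarrow> real) \<Rightarrow> real"
    where "g = (\<lambda>i t y. if t = 0 then 0 else relay_gain i * y (t - 1))"
  \<comment> \<open>Division by \<open>B\<close> undoes the input gain. The weights carry index
    \<open>t - 1\<close> because the signals of time \<open>t\<close> describe the previous state;
    at \<open>t = 0\<close> the truncated index is harmless since \<open>R i 0\<close> is 0.\<close>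
  define \<pi> :: "nat \<Rightarrow> (nat \<Rightarrow> nat \<Rightarrow> real) \<Rightarrow> real"
    where "\<pi> = (\<lambda>t r. \<Sum>i=1..L. (- (lam\<^sup>2) / B * weight i (t - 1)) * r i t)"
  define Se where "Se = (\<lambda>t \<omega>. if odd t then enc_gain t * state t \<omega> else 0)"
  define Y where "Y = (\<lambda>i t \<omega>. if odd t then Se t \<omega> + Zr i t \<omega> else 0)"
  define Sr where "Sr = (\<lambda>i t \<omega>. if even t \<and> t > 0 then relay_gain i * Y i (t - 1) \<omega> else 0)"
  define R where "R = (\<lambda>i t \<omega>. if even t \<and> t > 0 then Sr i t \<omega> + Zd i t \<omega> else 0)"
  define U where "U = (\<lambda>t \<omega>. \<Sum>i=1..L. (- (lam\<^sup>2) / B * weight i (t - 1)) * R i t \<omega>)"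
  have "linear_encoder f"
    unfolding linear_encoder_def
  proof
    fix t
    show "\<exists>a b. \<forall>x u. f t x u = (\<Sum>k\<le>t. a k * x k) + (\<Sum>k<t. b k * u k)"
      by (rule exI[of _ "\<lambda>k. if k = t then enc_gain t else 0"], rule exI[of _ "\<lambda>_. 0"])
        (simp add: f_def if_distrib[of "\<lambda>a. a * _"] cong: if_cong)
  qed
  moreover have "linear_relays L g"
    unfolding linear_relays_def
  proof (intro ballI allI)
    fix i t
    show "\<exists>c. \<forall>y. g i t y = (\<Sum>k<t. c k * y k)"
      by (rule exI[of _ "\<lambda>k. if k = t - 1 then relay_gain i else 0"])
        (cases t; simp add: g_def if_distrib[of "\<lambda>a. a * _"] cong: if_cong)
  qed
  moreover have "linear_controller L \<pi>"
    unfolding linear_controller_def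
  proof
    fix t
    show "\<exists>d. \<forall>r. \<pi> t r = (\<Sum>i=1..L. \<Sum>k\<le>t. d i k * r i k)"
      by (rule exI[of _ "\<lambda>i k. if k = t then - (lam\<^sup>2) / B * weight i (t - 1) else 0"])
        (simp add: \<pi>_def if_distrib[of "\<lambda>a. a * _"] cong: if_cong)
  qed
  moreover have "closed_loop M lam B L X0 W Zr Zd f g \<pi> state U Se Y Sr R"
    unfolding closed_loop_def
  proof (intro ballI conjI allI)
    fix \<omega> t
    show "state 0 \<omega> = X0 \<omega>" by simp
    show "state (Suc t) \<omega> = lam * state t \<omega> + B * U t \<omega> + W t \<omega>"
    proof (cases "odd t \<or> t = 0")
      case True
      then have "U t \<omega> = 0" by (auto simp: U_def R_def)
      then show ?thesis using True state_odd by auto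
    next
      case False
      then have "R i t \<omega> = received i (t - 1) (state (t - 1) \<omega>) \<omega>" for i
        by (auto simp: R_def Sr_def Y_def Se_def received_def)
      then have "B * U t \<omega> =
          - (lam\<^sup>2) * (\<Sum>i=1..L. weight i (t - 1) * received i (t - 1) (state (t - 1) \<omega>) \<omega>)"
        using B by (simp add: U_def sum_distrib_left mult_ac)
      then show ?thesis using False state_even by auto
    qed
    show "U t \<omega> = \<pi> t (\<lambda>i\<in>{1..L}. \<lambda>k\<in>{..t}. R i k \<omega>)"
      by (simp add: U_def \<pi>_def)
    show "Se t \<omega> = (if odd t then f t (\<lambda>k\<in>{..t}. state k \<omega>) (\<lambda>k\<in>{..<t}. U k \<omega>) else 0)"
      by (simp add: Se_def f_def)
    fix i assume "i \<in> {1..L}"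
    show "Y i t \<omega> = (if odd t then Se t \<omega> + Zr i t \<omega> else 0)"
      by (simp add: Y_def)
    show "Sr i t \<omega> = (if even t \<and> t > 0 then g i t (\<lambda>k\<in>{..<t}. Y i k \<omega>) else 0)"
      by (simp add: Sr_def g_def)
    show "R i t \<omega> = (if even t \<and> t > 0 then Sr i t \<omega> + Zd i t \<omega> else 0)"
      by (simp add: R_def)
  qed
  moreover have "has_power M (Se t) (2 * P_S)" if "odd t" for t
  proof -
    have "Se t = (\<lambda>\<omega>. enc_gain t * state t \<omega>)"
      using that by (simp add: Se_def)
    then have "moment2 M (Se t) = 2 * P_S" "square_int M (Se t)"
      using enc_gain_sq[OF that] square_int_cmult[OF state_square_int]
      by (simp_all add: moment2_cmult moment2_state)
    then show ?thesis
      by (simp add: has_power_def moment2_def square_int_def)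
  qed
  moreover have "has_power M (Sr i t) (2 * P_r i)" if i: "i \<in> {1..L}" and t: "even t \<and> t > 0" for i t
  proof -
    \<comment> \<open>The relay forwards what it heard one step earlier, at an odd time.\<close>
    obtain s where s: "t = Suc s" "odd s"
      using t by (cases t) auto
    have Sr: "Sr i t = (\<lambda>\<omega>. relay_gain i * (enc_gain s * state s \<omega> + Zr i s \<omega>))"
      using s by (simp add: Sr_def Y_def Se_def)
    have sq: "square_int M (\<lambda>\<omega>. enc_gain s * state s \<omega>)" "square_int M (Zr i s)"
      using square_int_cmult[OF state_square_int] gaussian_square_int(1)[OF Zr[OF i]] by auto
    moreover have "perp M (\<lambda>\<omega>. enc_gain s * state s \<omega>) (Zr i s)"
      using state_perp[OF Noise_in_sources(1)[OF i], of s s] by (simp add: perp_cmult)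
    \<comment> \<open>The relay hears power \<open>2 * P_S + N_r i\<close>;
      \<open>relay_gain\<close> is chosen to rescale exactly this to
      \<open>2 * P_r i\<close>.\<close>
    ultimately have "moment2 M (Sr i t) = (relay_gain i)\<^sup>2 * (2 * P_S + N_r i)"
      using gaussian_square_int(4)[OF Zr[OF i]] enc_gain_sq[OF s(2)]
      by (simp add: Sr moment2_cmult moment2_add moment2_state)
    also have "\<dots> = 2 * P_r i"
      using P_S noise_pos(2)[OF i] by (simp add: relay_gain_sq[OF i])
    finally have "moment2 M (Sr i t) = 2 * P_r i" .
    moreover have "square_int M (Sr i t)"
      unfolding Sr by (intro square_int_cmult square_int_add sq)
    ultimately show ?thesis
      by (simp add: has_power_def moment2_def square_int_def)
  qed
  moreover have "mean_square_stable M state"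
    using alpha_bounded[OF assms] state_square_int moment2_state
    by (simp add: mean_square_stable_def square_int_def moment2_def)
  ultimately show ?thesis
    by blast
qed

end

section \<open>From the logarithmic condition to the contraction condition\<close>

theorem theorem4p2:
  fixes M :: "'w measure"
    and lam B :: real
    and L :: nat
    and P_S P_R varX varW :: real
    and P_r N_r N_d :: "nat \<Rightarrow> real"
    and X0 :: "'w \<Rightarrow> real"
    and W :: "nat \<Rightarrow> 'w \<Rightarrow> real"
    and Zr Zd :: "nat \<Rightarrow> nat \<Rightarrow> 'w \<Rightarrow> real"
  assumes "prob_space M"
    and "\<bar>lam\<bar> \<ge> 1" and "B \<noteq> 0"
    and "\<exists>f. information_space.finite_entropy M 2 lborel X0 f"
    and "integrable M (\<lambda>\<omega>. (X0 \<omega>)\<^sup>2)" and "prob_space.variance M X0 = varX"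
    and "\<And>t. gaussian M (W t) varW"
    and "\<And>i t. i \<in> {1..L} \<Longrightarrow> gaussian M (Zr i t) (N_r i)"
    and "\<And>i t. i \<in> {1..L} \<Longrightarrow> gaussian M (Zd i t) (N_d i)"
    and "prob_space.indep_vars M (\<lambda>_. borel) (source_var X0 W Zr Zd) (sources L)"
    and "P_S \<ge> 0"
    and "\<And>i. i \<in> {1..L} \<Longrightarrow> P_r i \<ge> 0"
    and "(\<Sum>i=1..L. P_r i) \<le> P_R"
    and "log 2 \<bar>lam\<bar> < 1 / 4 * log 2 (1 + (\<Sum>i=1..L.
           4 * P_S * P_r i / (2 * P_S * N_d i + 2 * P_r i * N_r i + N_d i * N_r i)))"
  shows "\<exists>f g \<pi>. linear_encoder f \<and> linear_relays L g \<and> linear_controller L \<pi> \<and>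
           (\<exists>X U Se Y Sr R.
              closed_loop M lam B L X0 W Zr Zd f g \<pi> X U Se Y Sr R \<and>
              (\<forall>t. odd t \<longrightarrow> has_power M (Se t) (2 * P_S)) \<and>
              (\<forall>i\<in>{1..L}. \<forall>t. even t \<and> t > 0 \<longrightarrow> has_power M (Sr i t) (2 * P_r i)) \<and>
              mean_square_stable M X)"
proof -
  interpret parallel_network M lam B L P_S varW P_r N_r N_d X0 W Zr Zd
    by (intro parallel_network.intro parallel_network_axioms.intro assms)
  have "4 * log 2 \<bar>lam\<bar> < log 2 (1 + total_snr)"
    using assms(14) by (simp add: total_snr_def snr_def)
  moreover have "log 2 (lam ^ 4) = 4 * log 2 \<bar>lam\<bar>"
    using assms(2) log_nat_power[of "\<bar>lam\<bar>" 2 4] by simp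
  \<comment> \<open>Both arguments of the logarithm are positive: \<open>lam ^ 4\<close> because the
    absolute value of \<open>lam\<close> is at least 1, the other by
    \<open>total_snr_nonneg\<close>.\<close>
  ultimately have "lam ^ 4 < 1 + total_snr"
    using assms(2) total_snr_nonneg by (subst log_less_cancel_iff[of 2, symmetric]) auto
  then show ?thesis
    by (rule linear_scheme)
qed

end
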